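(* Let $L\ge 1$ be an integer and let $D_1,\dots,D_{2L}$ be data chunks such that $D_i\sim P_{old}$ for $i=1,\dots,L$ and $D_i\sim P_{new}$ for $i=L+1,\dots,2L$ (all samples in a given chunk come from the same distribution). For $0\le t\le L$ let $W_t=(D_{t+1},\dots,D_{t+L})$, so that after $L$ steps the window $W_L=(D_{L+1},\dots,D_{2L})$ consists entirely of data from $P_{new}$. Let $\theta_t^*$ be the model perfectly retrained on $W_t$, and let $\theta_t$ be the model obtained by unlearning and incremental updating: $$\theta_t^*=\mathrm{Train}(W_t)\quad(0\le t\le L),\qquad \theta_0=\theta_0^*,\qquad \theta_t=\mathrm{Train}\big(\mathrm{Unlearn}(\theta_{t-1},D_t),D_{t+L}\big)\quad(1\le t\le L).$$ Let the loss function $\ell(z,\theta)$ be $\mu$-strongly convex and $\beta$-smooth with respect to $\theta$, and let $\delta$ be such that $$\|\theta_t-\theta_t^*\|_2\le\|\theta_{t-1}-\theta_{t-1}^*\|_2+\delta\qquad\text{for all } t=1,\dots,L.$$ Then the expected loss of $\theta_L$ on the new distribution is bounded as follows: $$\mathbb{E}_{z\sim P_{new}}[\ell(z,\theta_L)]\le\mathbb{E}_{z\sim P_{new}}[\ell(z,\theta_L^* )]+\frac{\beta}{2}(L\cdot\delta)^2 .$$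
   Context: A data chunk is a finite sequence of $m$ labeled samples $z=(x,y)$ ($x$ a feature vector, $y$ its label). A model (classifier) is represented by its parameter vector $\theta$. $\mathrm{Train}$ is a training algorithm which can either train a model from scratch on a window of $L$ chunks, $\mathrm{Train}(W)$, or update a given model with one chunk, $\mathrm{Train}(\theta,D)$. $\mathrm{Unlearn}$ is an (approximate) unlearning algorithm which, given a model $\theta$ and a chunk $D$, returns a model $\mathrm{Unlearn}(\theta,D)$ from which the influence of $D$ is meant to be removed. The models $\theta_t^*$ are those of the sliding-window method (SW), perfectly retrained on $W_t$; the models $\theta_t$ are those of the UIL method (unlearn the oldest chunk, then update incrementally with the newest chunk). The per-step error is $\delta=\epsilon_{\text{unlearn}}+\epsilon_{\text{forgetting}}$, the sum of a parameter deviation due to approximate unlearning and one due to catastrophic forgetting during the incremental update. $\mathbb{E}_{z\sim P_{new}}[\ell(z,\theta)]$ is the expected loss of the model $\theta$ on the distribution $P_{new}$. A function $\ell(\theta)$ is $\mu$-strongly convex if $\ell(\theta')\ge \ell(\theta)+\langle\nabla \ell(\theta),\theta'-\theta\rangle+\frac{\mu}{2}\|\theta'-\theta\|^2$ for all $\theta,\theta'$. The $\beta$-smoothness of $\ell$ is used in the form of its consequence $\ell(\theta)-\ell(\theta')\le\langle\nabla \ell(\theta'),\theta-\theta'\rangle+\frac{\beta}{2}\|\theta-\theta'\|^2$ for all $\theta,\theta'$.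
   Formalization: The perfectly retrained model θ_L^* is additionally assumed to minimise the expected loss on P_new over all parameters (for arbitrary or empirical-risk training the bound fails), and the loss is assumed integrable under P_new for every parameter. *)

theory Defs
  imports "HOL-Probability.Probability"
begin

type_synonym ('d, 'y) sample = "(real ^ 'd) \<times> 'y"
type_synonym ('d, 'y) chunk = "('d, 'y) sample list"

(* A random chunk of m samples with law P.  Only the law of each single sample is
   prescribed; independence within or across chunks is not required. *)
definition random_chunk ::
  "'w measure \<Rightarrow> nat \<Rightarrow> ('d::finite, 'y) sample measure \<Rightarrow> ('w \<Rightarrow> ('d, 'y) chunk) \<Rightarrow> bool"
where
  "random_chunk M m P D \<longleftrightarrow>
     (\<forall>\<omega>\<in>space M. length (D \<omega>) = m) \<and>
     (\<forall>j<m. (\<lambda>\<omega>. D \<omega> ! j) \<in> measurable M P \<and> distr M P (\<lambda>\<omega>. D \<omega> ! j) = P)"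

(* The chunks t + 1, ..., t + L, oldest first. *)
definition window :: "nat \<Rightarrow> (nat \<Rightarrow> 'c) \<Rightarrow> nat \<Rightarrow> 'c list" where
  "window L D t = map D [t + 1..<t + L + 1]"

(* In the next two definitions g is the gradient at the respective point;
   it is unique whenever it exists. *)
definition strongly_convex :: "real \<Rightarrow> ('p::real_inner \<Rightarrow> real) \<Rightarrow> bool" where
  "strongly_convex \<mu> f \<longleftrightarrow>
     (\<forall>\<theta>. \<exists>g. GDERIV f \<theta> :> g \<and>
        (\<forall>\<theta>'. f \<theta>' \<ge> f \<theta> + g \<bullet> (\<theta>' - \<theta>) + \<mu> / 2 * (norm (\<theta>' - \<theta>))\<^sup>2))"

(* Smoothness in the form of the quadratic upper bound (the descent inequality),
   which every function with beta-Lipschitz gradient satisfies. *)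
definition smooth_fn :: "real \<Rightarrow> ('p::real_inner \<Rightarrow> real) \<Rightarrow> bool" where
  "smooth_fn \<beta> f \<longleftrightarrow>
     (\<forall>\<theta>'. \<exists>g. GDERIV f \<theta>' :> g \<and>
        (\<forall>\<theta>. f \<theta> - f \<theta>' \<le> g \<bullet> (\<theta> - \<theta>') + \<beta> / 2 * (norm (\<theta> - \<theta>'))\<^sup>2))"

definition expected_loss :: "'s measure \<Rightarrow> ('s \<Rightarrow> 'p \<Rightarrow> real) \<Rightarrow> 'p \<Rightarrow> real" where
  "expected_loss P l \<theta> = prob_space.expectation P (\<lambda>z. l z \<theta>)"

(* A model perfectly trained for the data distribution P: it attains the least
   expected loss among all parameter vectors. *)
definition perfect_model :: "'s measure \<Rightarrow> ('s \<Rightarrow> 'p \<Rightarrow> real) \<Rightarrow> 'p \<Rightarrow> bool" where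
  "perfect_model P l \<theta> \<longleftrightarrow> is_arg_min (expected_loss P l) (\<lambda>_. True) \<theta>"

end

theory Submission
  imports Defs
begin

text \<open>
  The quadratic upper bound at a minimiser \<open>x\<close> of the expected loss, applied to a step \<open>v\<close> and to the
  small backward step \<open>- h v\<close>, involves the same gradient, which can be eliminated between the two.
  The resulting inequality contains only loss values, so it can be integrated without discussing
  measurability or the expectation of the gradient. Minimality of \<open>x\<close> and \<open>h \<longlonglongrightarrow> 0\<close> then give
  an excess expected loss of at most \<open>\<beta> / 2 * (norm v)\<^sup>2\<close>, and the parameter error after \<open>L\<close> steps is
  at most \<open>L * \<delta>\<close>.
\<close>

lemma smooth_fn_two_steps:
  fixes f :: "'p::real_inner \<Rightarrow> real"
  assumes "smooth_fn \<beta> f" and "h > 0"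
  shows "h * (f (x + v) - f x) \<le> f x - f (x - h *\<^sub>R v) + \<beta> / 2 * (h + h\<^sup>2) * (norm v)\<^sup>2"
proof -
  obtain g where g: "\<And>y. f y - f x \<le> g \<bullet> (y - x) + \<beta> / 2 * (norm (y - x))\<^sup>2"
    using assms(1) unfolding smooth_fn_def by blast
  \<comment> \<open>The forward bound is scaled by \<open>h\<close> so that its linear term
    \<open>h * (g \<bullet> v)\<close> cancels that of the backward bound when the two are
    added.\<close>
  have "h * (f (x + v) - f x) \<le> h * (g \<bullet> v + \<beta> / 2 * (norm v)\<^sup>2)"
    using g[of "x + v"] \<open>h > 0\<close> by (intro mult_left_mono) auto
  moreover have "f (x - h *\<^sub>R v) - f x \<le> - h * (g \<bullet> v) + \<beta> / 2 * (h\<^sup>2 * (norm v)\<^sup>2)"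
    using g[of "x - h *\<^sub>R v"] by (simp add: power_mult_distrib)
  ultimately show ?thesis
    by (simp add: algebra_simps)
qed

lemma perfect_model_excess_loss:
  fixes l :: "'s \<Rightarrow> 'p::real_inner \<Rightarrow> real"
  assumes "prob_space P"
    and smooth: "\<And>z. z \<in> space P \<Longrightarrow> smooth_fn \<beta> (l z)"
    and int: "\<And>y. integrable P (\<lambda>z. l z y)"
    and perfect: "perfect_model P l x"
  shows "expected_loss P l y \<le> expected_loss P l x + \<beta> / 2 * (norm (y - x))\<^sup>2"
proof -
  interpret prob_space P by fact
  let ?F = "expected_loss P l"
  define v where "v = y - x"
  define c where "c = \<beta> / 2 * (norm v)\<^sup>2"
  have min: "?F x \<le> ?F w" for w
    using perfect by (auto simp: perfect_model_def is_arg_min_linorder)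
  have step: "?F y - ?F x \<le> c * (1 + h)" if "h > 0" for h
  proof -
    have "(\<integral>z. h * (l z y - l z x) \<partial>P)
        \<le> (\<integral>z. l z x - l z (x - h *\<^sub>R v) + \<beta> / 2 * (h + h\<^sup>2) * (norm v)\<^sup>2 \<partial>P)"
      using smooth_fn_two_steps[OF smooth \<open>h > 0\<close>, of _ x v]
      by (intro integral_mono) (auto simp: int v_def)
    then have "h * (?F y - ?F x) \<le> ?F x - ?F (x - h *\<^sub>R v) + \<beta> / 2 * (h + h\<^sup>2) * (norm v)\<^sup>2"
      by (simp add: expected_loss_def int prob_space)
    \<comment> \<open>Minimality makes \<open>?F x - ?F (x - h *\<^sub>R v)\<close> nonpositive, and
      \<open>h + h\<^sup>2 = h * (1 + h)\<close> leaves a factor \<open>h\<close> that can be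
      divided out.\<close>
    also have "\<dots> \<le> h * (c * (1 + h))"
      using min[of "x - h *\<^sub>R v"] by (simp add: c_def field_simps power2_eq_square)
    finally show ?thesis
      using \<open>h > 0\<close> by simp
  qed
  \<comment> \<open>The division by \<open>h\<close> rules out \<open>h = 0\<close>, so the surplus
    \<open>c * h\<close> is removed by a one-sided limit.\<close>
  have "((\<lambda>h. c * (1 + h)) \<longlongrightarrow> c * (1 + 0)) (at_right 0)"
    by (intro tendsto_intros)
  moreover have "\<forall>\<^sub>F h in at_right 0. ?F y - ?F x \<le> c * (1 + h)"
    using step by (auto simp: eventually_at_filter)
  ultimately have "?F y - ?F x \<le> c * (1 + 0)"
    by (intro tendsto_lowerbound) auto
  then show ?thesis
    by (simp add: c_def v_def)
qed

theorem theorem1: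
  fixes L m :: nat
    and \<mu> \<beta> \<delta> :: real
    and Y :: "'y measure"
    and P_old P_new :: "('d::finite, 'y) sample measure"
    and M :: "'w measure"
    and D :: "nat \<Rightarrow> 'w \<Rightarrow> ('d, 'y) chunk"
    and \<omega> :: 'w
    and loss :: "('d, 'y) sample \<Rightarrow> real ^ 'p::finite \<Rightarrow> real"
    and Train :: "('d, 'y) chunk list \<Rightarrow> real ^ 'p"
    and Train_upd :: "real ^ 'p \<Rightarrow> ('d, 'y) chunk \<Rightarrow> real ^ 'p"
    and Unlearn :: "real ^ 'p \<Rightarrow> ('d, 'y) chunk \<Rightarrow> real ^ 'p"
    and \<theta> \<theta>_star :: "nat \<Rightarrow> real ^ 'p"
  assumes L: "L \<ge> 1"
    and P_old: "prob_space P_old" "sets P_old = sets (borel \<Otimes>\<^sub>M Y)"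
    and P_new: "prob_space P_new" "sets P_new = sets (borel \<Otimes>\<^sub>M Y)"
    and M: "prob_space M"
    and D_old: "\<And>i. i \<in> {1..L} \<Longrightarrow> random_chunk M m P_old (D i)"
    and D_new: "\<And>i. i \<in> {L + 1..2 * L} \<Longrightarrow> random_chunk M m P_new (D i)"
    and \<omega>: "\<omega> \<in> space M"
    and SW: "\<And>t. t \<le> L \<Longrightarrow> \<theta>_star t = Train (window L (\<lambda>i. D i \<omega>) t)"
    and SW_perfect: "perfect_model P_new loss (\<theta>_star L)"
    and UIL_0: "\<theta> 0 = \<theta>_star 0"
    and UIL_step: "\<And>t. t \<in> {1..L} \<Longrightarrow>
          \<theta> t = Train_upd (Unlearn (\<theta> (t - 1)) (D t \<omega>)) (D (t + L) \<omega>)"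
    and \<mu>: "\<mu> > 0"
    and convex: "\<And>z. z \<in> space (borel \<Otimes>\<^sub>M Y) \<Longrightarrow> strongly_convex \<mu> (loss z)"
    and smooth: "\<And>z. z \<in> space (borel \<Otimes>\<^sub>M Y) \<Longrightarrow> smooth_fn \<beta> (loss z)"
    and loss_integrable: "\<And>\<theta>'. integrable P_new (\<lambda>z. loss z \<theta>')"
    and step_error: "\<And>t. t \<in> {1..L} \<Longrightarrow>
          norm (\<theta> t - \<theta>_star t) \<le> norm (\<theta> (t - 1) - \<theta>_star (t - 1)) + \<delta>"
  shows "expected_loss P_new loss (\<theta> L)
           \<le> expected_loss P_new loss (\<theta>_star L) + \<beta> / 2 * (real L * \<delta>)\<^sup>2"
proof -
  have "space P_new = space (borel \<Otimes>\<^sub>M Y)"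
    using P_new(2) by (rule sets_eq_imp_space_eq)
  then have excess: "expected_loss P_new loss y
      \<le> expected_loss P_new loss (\<theta>_star L) + \<beta> / 2 * (norm (y - \<theta>_star L))\<^sup>2" for y
    using perfect_model_excess_loss[OF P_new(1) _ loss_integrable SW_perfect] smooth by simp
  \<comment> \<open>Both methods start from the same model, so the error is 0 initially and each
    step adds at most \<delta>.\<close>
  have "norm (\<theta> t - \<theta>_star t) \<le> real t * \<delta>" if "t \<le> L" for t
    using that
  proof (induction t)
    case 0
    then show ?case by (simp add: UIL_0)
  next
    case (Suc t)
    then show ?case
      using step_error[of "Suc t"] by (simp add: algebra_simps)
  qed
  then have "(norm (\<theta> L - \<theta>_star L))\<^sup>2 \<le> (real L * \<delta>)\<^sup>2"
    by (intro power_mono) auto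
  \<comment> \<open>The sign of \<beta> follows from the excess bound at distance 1 from the
    minimiser: the excess there is nonnegative and at most \<open>\<beta> / 2\<close>. It is what
    allows the norm bound to be multiplied by \<open>\<beta> / 2\<close>.\<close>
  moreover have "\<beta> \<ge> 0"
  proof -
    obtain u :: "real ^ 'p" where "norm u = 1"
      using vector_choose_size[of 1] by auto
    moreover have "expected_loss P_new loss (\<theta>_star L) \<le> expected_loss P_new loss (\<theta>_star L + u)"
      using SW_perfect by (auto simp: perfect_model_def is_arg_min_linorder)
    ultimately show ?thesis
      using excess[of "\<theta>_star L + u"] by simp
  qed
  ultimately have "\<beta> / 2 * (norm (\<theta> L - \<theta>_star L))\<^sup>2 \<le> \<beta> / 2 * (real L * \<delta>)\<^sup>2"
    by (intro mult_left_mono) auto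
  then show ?thesis
    using excess[of "\<theta> L"] by linarith
qed

end
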